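(* (Recurrence formula.) The polynomials ${}_H\beta_n^{(a)}(x,v)$ satisfy $${}_H\beta_{n+1}^{(a)}(x,v)=\frac{1}{n-a+1}\Big((x-a)(n+1)\,{}_H\beta_n^{(a)}(x,v)-a\,{}_H\beta_{n+1}^{(a+1)}(x,v)-n(n+1)\,{}_H\beta_{n-1}^{(a)}(x,v)\Big).$$
   Context: Here $n\in\mathbb{N}_0=\{0,1,2,\dots\}$, $a$ is an integer and $v$ is a parameter; the base field is $\mathbb{C}$. The polynomials ${}_H\beta_n^{(a)}(x,v)$ in $x$ are defined by the generating function $$\left(\frac{t}{e^t-1}\right)^a e^{xt-\frac{v t^2}{2}}=\sum_{n=0}^\infty {}_H\beta_n^{(a)}(x,v)\frac{t^n}{n!}.$$
   Formalization: The last term is corrected from -n(n+1)β_{n-1} to -v n(n+1)β_{n-1} (as printed, the formula fails for a=0, n=1 and v≠1), and a ≠ n+1 is assumed so that 1/(n-a+1) is defined. *)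

theory Defs
  imports Complex_Main "HOL-Computational_Algebra.Formal_Power_Series"
begin

text \<open>
  The generating function is read as a formal power series in \<open>t\<close> (the series variable
  \<open>fps_X\<close>). The series of \<open>t / (e^t - 1)\<close> has constant coefficient 1, hence is a unit, so that
  its \<open>powi\<close> is the genuine \<open>a\<close>-th power also for negative \<open>a\<close>. The exponent
  \<open>x t - v t^2 / 2\<close> has constant coefficient 0, so that \<open>fps_compose\<close> is the genuine
  substitution into the exponential series.
\<close>

definition hermite_bernoulli_gf :: "int \<Rightarrow> complex \<Rightarrow> complex \<Rightarrow> complex fps" where
  "hermite_bernoulli_gf a x v =
     (fps_X / (fps_exp 1 - 1)) powi a *
     (fps_exp 1 oo (fps_const x * fps_X - fps_const (v / 2) * fps_X ^ 2))"

definition hermite_bernoulli :: "nat \<Rightarrow> int \<Rightarrow> complex \<Rightarrow> complex \<Rightarrow> complex" where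
  "hermite_bernoulli n a x v = fact n * fps_nth (hermite_bernoulli_gf a x v) n"

end

theory Submission
  imports Defs
begin

text \<open>
  The series \<open>B = t / (e^t - 1)\<close> satisfies the Riccati equation \<open>t B' = B - B^2 - t B\<close>. Hence the
  generating function \<open>G\<^sub>a = B^a e^(x t - v t^2 / 2)\<close> satisfies
  \<open>t G\<^sub>a' = a (G\<^sub>a - G\<^sub>(a+1) - t G\<^sub>a) + (x t - v t^2) G\<^sub>a\<close>, and the recurrence is the comparison of
  the coefficients of \<open>t^(n+1)\<close>.
\<close>

text \<open>Formal power series form no field; for negative \<open>a\<close> one factor cancels by
  \<open>f * inverse f = 1\<close>, which the nonzero constant coefficient supplies.\<close>

lemma fps_powi_add_1:
  fixes f :: "'a :: field fps"
  assumes "fps_nth f 0 \<noteq> 0"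
  shows "f powi (a + 1) = f * f powi a"
proof (cases "a \<ge> 0")
  case True
  then have "nat (a + 1) = Suc (nat a)" by simp
  with True show ?thesis by (simp add: power_int_def)
next
  case False
  define k where "k = nat (- (a + 1))"
  have a: "a = - int (Suc k)" using False by (simp add: k_def)
  have "f * inverse f = 1"
    using inverse_mult_eq_1'[OF assms] .
  then have "f * inverse f ^ Suc k = inverse f ^ k"
    by (simp add: mult.assoc[symmetric])
  moreover have "f powi a = inverse f ^ Suc k"
    using a by (auto simp: power_int_def nat_add_distrib)
  \<comment> \<open>For \<open>k = 0\<close>, that is \<open>a = -1\<close>, the exponent
    \<open>a + 1\<close> falls into the nonnegative branch of \<open>powi\<close>, hence the case
    split.\<close>
  moreover have "f powi (a + 1) = inverse f ^ k"
    using a by (cases k) (auto simp: power_int_def nat_add_distrib)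
  ultimately show ?thesis by simp
qed

text \<open>Logarithmic derivative, multiplied out so that neither a division nor the exponent
  \<open>a - 1\<close> occurs. For negative \<open>a\<close> the power rule is applied to
  \<open>inverse f\<close>.\<close>

lemma fps_deriv_powi:
  fixes f :: "'a :: field fps"
  assumes "fps_nth f 0 \<noteq> 0"
  shows "f * fps_deriv (f powi a) = of_int a * f powi a * fps_deriv f"
proof -
  have pow: "g * fps_deriv (g ^ k) = of_nat k * g ^ k * fps_deriv g" for g :: "'a fps" and k
  proof (induction k)
    case (Suc k)
    have "g * fps_deriv (g ^ Suc k) = g * (g * fps_deriv (g ^ k)) + g ^ Suc k * fps_deriv g"
      by (simp add: algebra_simps)
    then show ?case
      unfolding Suc.IH by (simp add: algebra_simps)
  qed simp
  show ?thesis
  proof (cases "a \<ge> 0")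
    case True
    then show ?thesis using pow[of f "nat a"] by (simp add: power_int_def)
  next
    case False
    define k where "k = nat (- a)"
    let ?g = "inverse f"
    have inv: "f * ?g = 1" using inverse_mult_eq_1'[OF assms] .
    have "fps_deriv (f * ?g) = 0" unfolding inv by simp
    then have d: "f * fps_deriv ?g = - (?g * fps_deriv f)"
      by (simp add: eq_neg_iff_add_eq_0 algebra_simps)
    \<comment> \<open>The power rule \<open>pow\<close> needs a factor \<open>?g\<close> in front of
      the derivative; it is inserted here and cancelled at the end.\<close>
    have "?g * (f * fps_deriv (?g ^ k)) = f * (?g * fps_deriv (?g ^ k))"
      by (simp only: mult.left_commute)
    also have "\<dots> = of_nat k * ?g ^ k * (f * fps_deriv ?g)"
      unfolding pow by (simp only: mult_ac)
    also have "\<dots> = ?g * (- of_nat k * ?g ^ k * fps_deriv f)"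
      unfolding d by (simp add: algebra_simps)
    finally have "?g * (f * fps_deriv (?g ^ k)) = ?g * (- of_nat k * ?g ^ k * fps_deriv f)" .
    moreover have "?g \<noteq> 0"
      using inv by (metis mult_zero_right zero_neq_one)
    ultimately have "f * fps_deriv (?g ^ k) = - of_nat k * ?g ^ k * fps_deriv f"
      by (rule mult_left_cancel[THEN iffD1, rotated])
    moreover have "f powi a = ?g ^ k"
      using False by (simp add: power_int_def k_def)
    moreover have "- of_nat k = (of_int a :: 'a fps)"
      using False by (simp add: k_def of_nat_nat)
    ultimately show ?thesis by simp
  qed
qed

abbreviation bernoulli_gf :: "complex fps" where
  "bernoulli_gf \<equiv> fps_X / (fps_exp 1 - 1)"

text \<open>The quotient is exact because \<open>e^t - 1\<close> has subdegree 1, the same as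
  \<open>t\<close>.\<close>

lemma bernoulli_gf_mult: "bernoulli_gf * (fps_exp 1 - 1) = fps_X"
proof -
  have nz: "fps_exp 1 - 1 \<noteq> (0 :: complex fps)"
  proof
    assume "fps_exp 1 - 1 = (0 :: complex fps)"
    then have "fps_nth (fps_exp 1 - 1 :: complex fps) 1 = 0" by simp
    then show False by simp
  qed
  have "subdegree (fps_exp 1 - 1 :: complex fps) = 1"
    by (rule subdegreeI) auto
  then have "(fps_exp 1 - 1 :: complex fps) dvd fps_X"
    using nz by (simp add: fps_dvd_iff)
  then show ?thesis by simp
qed

lemma bernoulli_gf_nth_0: "fps_nth bernoulli_gf 0 \<noteq> 0"
proof -
  have "fps_nth (bernoulli_gf * (fps_exp 1 - 1)) 1 = 1"
    unfolding bernoulli_gf_mult by simp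
  then show ?thesis by (auto simp: fps_mult_nth)
qed

text \<open>Differentiate \<open>B (e^t - 1) = t\<close> and use the same relation again to
  eliminate \<open>e^t\<close>.\<close>

lemma bernoulli_gf_deriv:
  "fps_X * fps_deriv bernoulli_gf = bernoulli_gf - bernoulli_gf ^ 2 - fps_X * bernoulli_gf"
proof -
  define B where "B = bernoulli_gf"
  define e where "e = (fps_exp 1 :: complex fps)"
  have B: "B * (e - 1) = fps_X"
    unfolding B_def e_def by (rule bernoulli_gf_mult)
  have "fps_deriv (B * (e - 1)) = 1" unfolding B by simp
  then have d: "fps_deriv B * (e - 1) + B * e = 1"
    by (simp add: e_def algebra_simps)
  have "fps_X * fps_deriv B = B * (fps_deriv B * (e - 1))"
    unfolding B[symmetric] by (simp only: mult_ac)
  also have "\<dots> = B * (1 - B * e)"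
    using d by (simp add: eq_diff_eq)
  also have "\<dots> = B - B ^ 2 - (B * (e - 1)) * B"
    by (simp add: algebra_simps power2_eq_square)
  finally show ?thesis unfolding B by (simp add: B_def)
qed

lemma hermite_bernoulli_gf_deriv:
  "fps_X * fps_deriv (hermite_bernoulli_gf a x v) =
     of_int a * (hermite_bernoulli_gf a x v - hermite_bernoulli_gf (a + 1) x v
       - fps_X * hermite_bernoulli_gf a x v)
     + (fps_const x * fps_X - fps_const v * fps_X ^ 2) * hermite_bernoulli_gf a x v"
proof -
  define B where "B = bernoulli_gf"
  define q where "q = fps_const x * fps_X - fps_const (v / 2) * fps_X ^ 2"
  define E where "E = fps_exp 1 oo q"
  define P where "P = B powi a"
  have B0: "fps_nth B 0 \<noteq> 0" unfolding B_def by (rule bernoulli_gf_nth_0)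
  have G: "hermite_bernoulli_gf a x v = P * E"
    by (simp add: hermite_bernoulli_gf_def P_def B_def E_def q_def)
  have G1: "hermite_bernoulli_gf (a + 1) x v = B * P * E"
    using fps_powi_add_1[OF B0, of a]
    by (simp add: hermite_bernoulli_gf_def P_def B_def E_def q_def)
  have "fps_const (v / 2) * 2 = fps_const v"
    by (simp add: numeral_fps_const)
  then have q': "fps_X * fps_deriv q = fps_const x * fps_X - fps_const v * fps_X ^ 2"
    by (simp add: q_def fps_deriv_power algebra_simps power2_eq_square)
  \<comment> \<open>The chain rule applies since \<open>q\<close> has constant coefficient
    0.\<close>
  have E': "fps_deriv E = E * fps_deriv q"
    unfolding E_def by (subst fps_compose_deriv) (simp_all add: q_def)
  have P': "B * fps_deriv P = of_int a * P * fps_deriv B"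
    unfolding P_def by (rule fps_deriv_powi[OF B0])
  have "B * (fps_X * fps_deriv P) = of_int a * P * (fps_X * fps_deriv B)"
    by (subst mult.left_commute, subst P') (simp only: mult_ac)
  also have "\<dots> = B * (of_int a * (P - B * P - fps_X * P))"
    unfolding bernoulli_gf_deriv B_def by (simp add: algebra_simps power2_eq_square)
  finally have XP': "fps_X * fps_deriv P = of_int a * (P - B * P - fps_X * P)"
    using B0 by auto
  have "fps_X * fps_deriv (P * E) = (fps_X * fps_deriv P) * E + (fps_X * fps_deriv q) * (P * E)"
    by (simp add: E' algebra_simps)
  then show ?thesis
    unfolding G G1 XP' q' by (simp add: algebra_simps)
qed

text \<open>The last term carries the factor \<open>v\<close>, which comes from differentiating
  \<open>- v t^2 / 2\<close>. The informal formula omits it and fails already for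
  \<open>a = 0\<close>, \<open>n = 1\<close> and \<open>v\<close> other than 1, where the left side
  is \<open>x^2 - v\<close>.\<close>

theorem theorem5:
  fixes n :: nat and a :: int and x v :: complex
  assumes "int n - a + 1 \<noteq> 0"
  shows "hermite_bernoulli (n + 1) a x v =
    1 / (of_nat n - of_int a + 1) *
      ((x - of_int a) * of_nat (n + 1) * hermite_bernoulli n a x v
       - of_int a * hermite_bernoulli (n + 1) (a + 1) x v
       - v * of_nat n * of_nat (n + 1) * hermite_bernoulli (n - 1) a x v)"
proof -
  define G where "G = hermite_bernoulli_gf a x v"
  define H where "H = hermite_bernoulli_gf (a + 1) x v"
  \<comment> \<open>This is the coefficient of \<open>t^(n+1)\<close> in \<open>t^2 G\<close>; at
    \<open>n = 0\<close> it must be 0, whereas truncated subtraction would give the constant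
    coefficient of \<open>G\<close>.\<close>
  define g where "g = (if n = 0 then 0 else fps_nth G (n - 1))"
  have "fps_X * fps_deriv G = fps_const (of_int a) * (G - H - fps_X * G)
      + (fps_const x * (fps_X * G) - fps_const v * (fps_X * (fps_X * G)))"
    unfolding G_def H_def hermite_bernoulli_gf_deriv
    by (simp add: fps_of_int algebra_simps power2_eq_square)
  then have "fps_nth (fps_X * fps_deriv G) (n + 1) =
      fps_nth (fps_const (of_int a) * (G - H - fps_X * G)
        + (fps_const x * (fps_X * G) - fps_const v * (fps_X * (fps_X * G)))) (n + 1)"
    by (rule arg_cong)
  then have coeff: "of_nat (n + 1) * fps_nth G (n + 1) =
      of_int a * (fps_nth G (n + 1) - fps_nth H (n + 1) - fps_nth G n) + (x * fps_nth G n - v * g)"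
    by (simp add: g_def)
  \<comment> \<open>At \<open>n = 0\<close> both sides vanish, the left one by its factor
    \<open>n\<close>; otherwise \<open>(n+1)! = (n+1) n (n-1)!\<close>.\<close>
  have fact_g: "of_nat n * of_nat (n + 1) * hermite_bernoulli (n - 1) a x v = fact (n + 1) * g"
    by (cases n) (simp_all add: hermite_bernoulli_def g_def G_def algebra_simps)
  have "of_nat n - of_int a + 1 = (of_int (int n - a + 1) :: complex)" by simp
  then have nz: "of_nat n - of_int a + 1 \<noteq> (0 :: complex)"
    using assms by (metis of_int_eq_0_iff)
  \<comment> \<open>The coefficient of \<open>t^(n+1)\<close> in \<open>G\<close> occurs on both
    sides of \<open>coeff\<close>, with factors \<open>n + 1\<close> and \<open>a\<close>;
    collecting it yields the denominator of the recurrence.\<close>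
  have lin: "(of_nat n - of_int a + 1) * fps_nth G (n + 1) =
      (x - of_int a) * fps_nth G n - of_int a * fps_nth H (n + 1) - v * g"
    using coeff by (simp add: algebra_simps)
  have "(of_nat n - of_int a + 1) * hermite_bernoulli (n + 1) a x v =
      fact (n + 1) * ((of_nat n - of_int a + 1) * fps_nth G (n + 1))"
    by (simp add: hermite_bernoulli_def G_def)
  also have "\<dots> = (x - of_int a) * of_nat (n + 1) * hermite_bernoulli n a x v
       - of_int a * hermite_bernoulli (n + 1) (a + 1) x v - v * (fact (n + 1) * g)"
    unfolding lin by (simp add: hermite_bernoulli_def G_def H_def algebra_simps)
  finally show ?thesis
    unfolding fact_g[symmetric] using nz by (simp add: nonzero_eq_divide_eq mult_ac)
qed

end
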